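(* Let $g:\mathbb{Z}\to\mathbb{R}$ be the impulse response of a causal system (so $g(t)=0$ for $t<0$) with $\sum_{t\in\mathbb{Z}}|g(t)|<\infty$, whose support is an infinite interval $\{k,k+1,k+2,\dots\}$ for some $k\in\mathbb{Z}_{\ge 0}$, which is strictly monotonically decreasing on its support, and for which $g(0)>0$. Let $\chi_0\ge 0$. Then for no $P\in\mathbb{Z}_{>0}$ does there exist a $P$-periodic sequence $u:\mathbb{Z}\to\mathbb{R}$ with $S_c^-(\Delta_c u^P)=2$ and $S_c^+(\mathrm{rel}_{\chi_0}(u^P))=2$ such that $$u=-\mathcal{C}_g(\mathrm{rel}_{\chi_0}(u)).$$
   Context: Support: $\mathrm{supp}(g)=\{i\in\mathbb{Z}: g(i)\neq 0\}$. Convolution operator: $\mathcal{C}_g(x)(t)=\sum_{\tau\in\mathbb{Z}}g(t-\tau)x(\tau)$ for bounded $x:\mathbb{Z}\to\mathbb{R}$, $t\in\mathbb{Z}$. Truncation: for a $P$-periodic sequence $x$, $x^P=[x(0),\dots,x(P-1)]^\top\in\mathbb{R}^P$. Relay with dead zone: for $\chi_0\ge 0$ and $x\in\mathbb{R}$, $\mathrm{rel}_{\chi_0}(x)=1$ if $x>\chi_0$, $-1$ if $x<-\chi_0$, and $0$ otherwise; applied entrywise to vectors and sequences. Cyclic forward difference: for $v\in\mathbb{R}^n$, $\Delta_c v=[v_2-v_1,\,v_3-v_2,\dots,v_n-v_{n-1},\,v_1-v_n]^\top$. Variation: for $v\neq 0$, $S^-(v)$ is the number of sign changes between consecutive entries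 of the vector obtained from $v$ by deleting all zeros; $S^-(0)=-1$. Cyclic variation: $S_c^-(v)=\max_{1\le i\le n}S^-([v_i,\dots,v_n,v_1,\dots,v_i])$. $S_c^+(v)$ is the maximum of $S_c^-(\bar v)$ over all $\bar v\in\mathbb{R}^n$ obtained from $v$ by replacing its zero entries by arbitrary real numbers. *)

theory Defs
  imports "HOL-Analysis.Analysis"
begin

text \<open>
  Sequences are functions \<^typ>\<open>int \<Rightarrow> real\<close>; vectors, whose dimension varies, are real lists,
  indexed from \<open>0\<close>.
\<close>

definition supp :: "(int \<Rightarrow> real) \<Rightarrow> int set" where
  "supp g = {i. g i \<noteq> 0}"

definition conv_op :: "(int \<Rightarrow> real) \<Rightarrow> (int \<Rightarrow> real) \<Rightarrow> int \<Rightarrow> real" where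
  "conv_op g x t = (\<Sum>\<^sub>\<infinity>\<tau>\<in>UNIV. g (t - \<tau>) * x \<tau>)"

definition periodic_seq :: "nat \<Rightarrow> (int \<Rightarrow> real) \<Rightarrow> bool" where
  "periodic_seq P x \<longleftrightarrow> (\<forall>t. x (t + int P) = x t)"

definition trunc :: "nat \<Rightarrow> (int \<Rightarrow> real) \<Rightarrow> real list" where
  "trunc P x = map (\<lambda>i. x (int i)) [0..<P]"

definition rel :: "real \<Rightarrow> real \<Rightarrow> real" where
  "rel \<chi>\<^sub>0 x = (if x > \<chi>\<^sub>0 then 1 else if x < - \<chi>\<^sub>0 then - 1 else 0)"

definition cyc_diff :: "real list \<Rightarrow> real list" where
  "cyc_diff v = map (\<lambda>i. v ! (Suc i mod length v) - v ! i) [0..<length v]"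

definition variation :: "real list \<Rightarrow> int" where
  "variation v =
    (if \<forall>x\<in>set v. x = 0 then - 1
     else let w = filter (\<lambda>x. x \<noteq> 0) v
          in int (card {i. Suc i < length w \<and> sgn (w ! i) \<noteq> sgn (w ! Suc i)}))"

text \<open>
  With 0-based \<open>i\<close>, \<open>drop i v @ take (Suc i) v\<close> is the cyclic rotation of \<open>v\<close> starting at
  entry \<open>i\<close>, closed up by repeating that entry at the end. Only nonempty vectors are meaningful.
\<close>

definition cyc_variation :: "real list \<Rightarrow> int" where
  "cyc_variation v = Max ((\<lambda>i. variation (drop i v @ take (Suc i) v)) ` {..<length v})"

definition zero_replacements :: "real list \<Rightarrow> real list set" where
  "zero_replacements v =
    {w. length w = length v \<and> (\<forall>i<length v. v ! i \<noteq> 0 \<longrightarrow> w ! i = v ! i)}"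

definition cyc_variation_plus :: "real list \<Rightarrow> int" where
  "cyc_variation_plus v = Max (cyc_variation ` zero_replacements v)"

text \<open>
  \<^const>\<open>zero_replacements\<close> is infinite in general, but only finitely many values are attained,
  so the maximum above is a genuine one.
\<close>

lemma variation_bounds: "variation v \<in> {- 1..int (length v)}"
proof -
  define w where "w = filter (\<lambda>x. x \<noteq> 0) v"
  have "card {i. Suc i < length w \<and> sgn (w ! i) \<noteq> sgn (w ! Suc i)} \<le> card {..<length w}"
    by (rule card_mono) auto
  also have "\<dots> \<le> length v"
    by (simp add: w_def)
  finally show ?thesis
    by (auto simp: variation_def Let_def w_def)
qed

lemma cyc_variation_bounds:
  assumes "v \<noteq> []"
  shows "cyc_variation v \<in> {- 1..int (Suc (length v))}"
proof -
  let ?V = "(\<lambda>i. variation (drop i v @ take (Suc i) v)) ` {..<length v}"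
  have "Max ?V \<in> ?V"
    using assms by (intro Max_in) auto
  then obtain i where i: "i < length v"
    and eq: "cyc_variation v = variation (drop i v @ take (Suc i) v)"
    unfolding cyc_variation_def by auto
  have "length (drop i v @ take (Suc i) v) = Suc (length v)"
    using i by simp
  then show ?thesis
    using variation_bounds[of "drop i v @ take (Suc i) v"] eq by simp
qed

lemma finite_cyc_variation_zero_replacements:
  assumes "v \<noteq> []"
  shows "finite (cyc_variation ` zero_replacements v)"
proof (rule finite_subset)
  show "cyc_variation ` zero_replacements v \<subseteq> {- 1..int (Suc (length v))}"
  proof
    fix y assume "y \<in> cyc_variation ` zero_replacements v"
    then obtain w where "length w = length v" "y = cyc_variation w"
      by (auto simp: zero_replacements_def)
    moreover from this assms have "w \<noteq> []" by auto
    ultimately show "y \<in> {- 1..int (Suc (length v))}"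
      using cyc_variation_bounds[of w] by simp
  qed
qed simp

lemma zero_replacements_self: "v \<in> zero_replacements v"
  by (simp add: zero_replacements_def)

end

theory Submission
  imports Defs
begin

text \<open>
  As \<open>g 0 > 0\<close>, the support of \<open>g\<close> is \<open>{0..}\<close>, and \<open>g\<close> decreases there to the limit \<open>0\<close>, so it is
  nonnegative. For such a kernel the equation \<open>u = - C\<^sub>g (rel u)\<close> has only the solution \<open>u = 0\<close>,
  and the differences of the zero sequence have cyclic variation \<open>-1\<close>, not \<open>2\<close>.

  The reason is that feedback through such a kernel cannot make \<open>u\<close> step up to the value at which
  the relay saturates. Suppose the relay output \<open>x = rel u\<close> equals its maximal value \<open>1\<close> at time
  \<open>T\<close>. Passing from \<open>T - 1\<close> to \<open>T\<close>, a causal decreasing kernel moves weight from past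
  inputs to the present one, which is the largest, so the convolution does not decrease
  (lemma \<open>conv_op_le_at_max\<close>). With the negative feedback, \<open>u (T - 1) \<ge> u T\<close>, so the relay
  was at \<open>1\<close> already at time \<open>T - 1\<close>, and by descent at all times before \<open>T\<close>. But then
  \<open>u T = - (g 0 + g 1 + \<dots>) \<le> 0\<close>, which contradicts that the relay is at \<open>1\<close> at time \<open>T\<close>.
  The value \<open>-1\<close> is excluded by the symmetry \<open>u \<mapsto> -u\<close>. So the relay is silent at all times,
  and \<open>u = 0\<close>.
\<close>

lemma summable_on_conv_op:
  fixes g x :: "int \<Rightarrow> real"
  assumes "(\<lambda>t. \<bar>g t\<bar>) summable_on UNIV" and "\<And>t. \<bar>x t\<bar> \<le> b"
  shows "(\<lambda>\<tau>. g (t - \<tau>) * x \<tau>) summable_on UNIV"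
proof -
  have "bij (\<lambda>\<tau>. t - \<tau>)"
    by (rule bij_betw_byWitness[of _ "\<lambda>\<tau>. t - \<tau>"]) auto
  then have "(\<lambda>\<tau>. \<bar>g (t - \<tau>)\<bar>) summable_on UNIV"
    using assms(1) summable_on_reindex_bij_betw[of "\<lambda>\<tau>. t - \<tau>" UNIV UNIV "\<lambda>t. \<bar>g t\<bar>"] by simp
  then have "(\<lambda>\<tau>. \<bar>g (t - \<tau>)\<bar> * b) summable_on UNIV"
    by (rule summable_on_cmult_left)
  then have "(\<lambda>\<tau>. norm (g (t - \<tau>) * x \<tau>)) summable_on UNIV"
    by (rule summable_on_comparison_test) (auto simp: abs_mult assms(2) mult_left_mono)
  then show ?thesis
    by (rule abs_summable_summable)
qed

lemma conv_op_const: "conv_op g (\<lambda>_. c) t = (\<Sum>\<^sub>\<infinity>\<tau>. g \<tau> * c)"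
proof -
  have "bij (\<lambda>\<tau>. t - \<tau>)"
    by (rule bij_betw_byWitness[of _ "\<lambda>\<tau>. t - \<tau>"]) auto
  then show ?thesis
    unfolding conv_op_def
    using infsum_reindex_bij_betw[of "\<lambda>\<tau>. t - \<tau>" UNIV UNIV "\<lambda>\<tau>. g \<tau> * c"] by simp
qed

text \<open>
  Convolution with a constant gives a constant, so the inequality may be checked for the input
  \<open>x - x T\<close>. This input is nonpositive and vanishes at \<open>T\<close>, the only time at which the weight
  can increase from \<open>T - 1\<close> to \<open>T\<close>; hence the inequality holds term by term.
\<close>

lemma conv_op_le_at_max:
  fixes g x :: "int \<Rightarrow> real"
  assumes causal: "\<And>t. t < 0 \<Longrightarrow> g t = 0"
    and summable: "(\<lambda>t. \<bar>g t\<bar>) summable_on UNIV"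
    and decreasing: "\<And>t. t \<ge> 0 \<Longrightarrow> g (t + 1) \<le> g t"
    and bounded: "\<And>t. \<bar>x t\<bar> \<le> b"
    and max: "\<And>t. x t \<le> x T"
  shows "conv_op g x (T - 1) \<le> conv_op g x T"
proof -
  have sx: "(\<lambda>\<tau>. g (t - \<tau>) * x \<tau>) summable_on UNIV" for t
    by (rule summable_on_conv_op[OF summable bounded])
  have sc: "(\<lambda>\<tau>. g (t - \<tau>) * x T) summable_on UNIV" for t
    by (rule summable_on_conv_op[OF summable order_refl])
  have "conv_op g x (T - 1) + conv_op g (\<lambda>_. x T) T
      = (\<Sum>\<^sub>\<infinity>\<tau>. g (T - 1 - \<tau>) * x \<tau> + g (T - \<tau>) * x T)"
    unfolding conv_op_def by (rule infsum_add[OF sx[of "T - 1"] sc[of T], symmetric])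
  also have "\<dots> \<le> (\<Sum>\<^sub>\<infinity>\<tau>. g (T - \<tau>) * x \<tau> + g (T - 1 - \<tau>) * x T)"
  proof (rule infsum_mono)
    show "(\<lambda>\<tau>. g (T - 1 - \<tau>) * x \<tau> + g (T - \<tau>) * x T) summable_on UNIV"
      by (rule summable_on_add[OF sx[of "T - 1"] sc[of T]])
    show "(\<lambda>\<tau>. g (T - \<tau>) * x \<tau> + g (T - 1 - \<tau>) * x T) summable_on UNIV"
      by (rule summable_on_add[OF sx[of T] sc[of "T - 1"]])
    fix \<tau> :: int
    consider "\<tau> < T" | "\<tau> = T" | "\<tau> > T" by linarith
    then have "(g (T - \<tau>) - g (T - 1 - \<tau>)) * (x \<tau> - x T) \<ge> 0"
    proof cases
      case 1
      then have "g (T - 1 - \<tau> + 1) \<le> g (T - 1 - \<tau>)"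
        by (intro decreasing) simp
      then show ?thesis
        using max[of \<tau>] by (simp add: mult_nonpos_nonpos)
    qed (simp_all add: causal)
    then show "g (T - 1 - \<tau>) * x \<tau> + g (T - \<tau>) * x T
        \<le> g (T - \<tau>) * x \<tau> + g (T - 1 - \<tau>) * x T"
      by (simp add: algebra_simps)
  qed
  also have "\<dots> = conv_op g x T + conv_op g (\<lambda>_. x T) (T - 1)"
    unfolding conv_op_def by (rule infsum_add[OF sx[of T] sc[of "T - 1"]])
  finally show ?thesis
    by (simp add: conv_op_const)
qed

lemma nonneg_if_decreasing_summable:
  fixes g :: "int \<Rightarrow> real"
  assumes causal: "\<And>t. t < 0 \<Longrightarrow> g t = 0"
    and summable: "(\<lambda>t. \<bar>g t\<bar>) summable_on UNIV"
    and decreasing: "\<And>t. t \<ge> 0 \<Longrightarrow> g (t + 1) \<le> g t"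
  shows "g t \<ge> 0"
proof (cases "t < 0")
  case False
  have "(\<lambda>t. \<bar>g t\<bar>) summable_on range int"
    using summable by (rule summable_on_subset_banach) simp
  then have "(\<lambda>n. norm (g (int n))) summable_on UNIV"
    using summable_on_reindex[of int UNIV "\<lambda>t. \<bar>g t\<bar>"] by (simp add: o_def)
  then have "summable (\<lambda>n. g (int n))"
    by (rule summable_on_imp_summable[OF abs_summable_summable])
  then have "(\<lambda>n. g (int n)) \<longlonglongrightarrow> 0"
    by (rule summable_LIMSEQ_zero)
  moreover have "decseq (\<lambda>n. g (int n))"
    using decreasing[of "int _"] by (intro decseq_SucI) (simp add: add.commute)
  ultimately have "g (int (nat t)) \<ge> 0"
    by (rule decseq_ge[rotated])
  with False show ?thesis by simp
qed (simp add: causal)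

lemma abs_rel_le_1: "\<bar>rel c a\<bar> \<le> 1"
  by (simp add: rel_def)

lemma rel_minus:
  assumes "c \<ge> 0"
  shows "rel c (- a) = - rel c a"
  using assms by (auto simp: rel_def)

lemma conv_op_uminus: "conv_op g (\<lambda>\<tau>. - x \<tau>) t = - conv_op g x t"
  by (simp add: conv_op_def infsum_uminus)

text \<open>
  If the relay were at \<open>1\<close> at time \<open>T\<close>, then by descent it would be at \<open>1\<close> at all times up to
  \<open>T\<close>, and the nonnegative kernel, fed back with a minus sign, would give \<open>u T \<le> 0\<close>.
\<close>

lemma relay_feedback_le:
  fixes g u :: "int \<Rightarrow> real"
  assumes causal: "\<And>t. t < 0 \<Longrightarrow> g t = 0"
    and summable: "(\<lambda>t. \<bar>g t\<bar>) summable_on UNIV"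
    and decreasing: "\<And>t. t \<ge> 0 \<Longrightarrow> g (t + 1) \<le> g t"
    and "c \<ge> 0"
    and feedback: "\<And>t. u t = - conv_op g (\<lambda>\<tau>. rel c (u \<tau>)) t"
  shows "u T \<le> c"
proof (rule ccontr)
  assume "\<not> u T \<le> c"
  have descent: "u (t - 1) > c" if "u t > c" for t
  proof -
    have "conv_op g (\<lambda>\<tau>. rel c (u \<tau>)) (t - 1) \<le> conv_op g (\<lambda>\<tau>. rel c (u \<tau>)) t"
    proof (rule conv_op_le_at_max[where g = g and b = 1])
      show "\<bar>rel c (u s)\<bar> \<le> 1" for s
        by (rule abs_rel_le_1)
      show "rel c (u s) \<le> rel c (u t)" for s
        using that by (simp add: rel_def)
    qed (use causal summable decreasing in auto)
    then show ?thesis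
      using that feedback[of t] feedback[of "t - 1"] by linarith
  qed
  have past: "u \<tau> > c" if "\<tau> \<le> T" for \<tau>
    using that
  proof (induction rule: int_le_induct)
    case base
    show ?case using \<open>\<not> u T \<le> c\<close> by simp
  next
    case (step i)
    then show ?case by (simp add: descent)
  qed
  have "g (T - \<tau>) * rel c (u \<tau>) \<ge> 0" for \<tau>
  proof (cases "\<tau> \<le> T")
    case True
    then show ?thesis
      using past[of \<tau>] nonneg_if_decreasing_summable[of g, OF causal summable decreasing]
      by (simp add: rel_def)
  qed (simp add: causal)
  then have "conv_op g (\<lambda>\<tau>. rel c (u \<tau>)) T \<ge> 0"
    unfolding conv_op_def by (intro infsum_nonneg)
  then show False
    using feedback[of T] \<open>c \<ge> 0\<close> \<open>\<not> u T \<le> c\<close> by linarith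
qed

lemma relay_feedback_trivial:
  fixes g u :: "int \<Rightarrow> real"
  assumes causal: "\<And>t. t < 0 \<Longrightarrow> g t = 0"
    and summable: "(\<lambda>t. \<bar>g t\<bar>) summable_on UNIV"
    and decreasing: "\<And>t. t \<ge> 0 \<Longrightarrow> g (t + 1) \<le> g t"
    and "c \<ge> 0"
    and feedback: "\<And>t. u t = - conv_op g (\<lambda>\<tau>. rel c (u \<tau>)) t"
  shows "u t = 0"
proof -
  have upper: "u \<tau> \<le> c" for \<tau>
    by (rule relay_feedback_le[of g c u, OF causal summable decreasing \<open>c \<ge> 0\<close> feedback])
  have "- u s = - conv_op g (\<lambda>\<tau>. rel c (- u \<tau>)) s" for s
    using feedback[of s] \<open>c \<ge> 0\<close> by (simp add: rel_minus conv_op_uminus)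
  from relay_feedback_le[of g c "\<lambda>\<tau>. - u \<tau>", OF causal summable decreasing \<open>c \<ge> 0\<close> this]
  have lower: "- u \<tau> \<le> c" for \<tau> .
  have "rel c (u \<tau>) = 0" for \<tau>
    using upper[of \<tau>] lower[of \<tau>] by (simp add: rel_def)
  then show ?thesis
    using feedback[of t] by (simp add: conv_op_def)
qed

lemma cyc_variation_eq_neg_1_if_zero:
  assumes "v \<noteq> []" and "\<forall>a\<in>set v. a = 0"
  shows "cyc_variation v = - 1"
proof -
  have "variation (drop i v @ take (Suc i) v) = - 1" for i
    using assms(2) by (auto simp: variation_def dest: in_set_dropD in_set_takeD)
  then show ?thesis
    using assms(1) by (simp add: cyc_variation_def image_constant_conv lessThan_empty_iff)
qed

theorem theorem3:
  fixes g :: "int \<Rightarrow> real" and k :: int and \<chi>\<^sub>0 :: real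
  assumes causal: "\<And>t. t < 0 \<Longrightarrow> g t = 0"
    and summable: "(\<lambda>t. \<bar>g t\<bar>) summable_on UNIV"
    and k_nonneg: "k \<ge> 0"
    and supp_g: "supp g = {k..}"
    and decreasing: "strict_antimono_on (supp g) g"
    and g0_pos: "g 0 > 0"
    and dead_zone: "\<chi>\<^sub>0 \<ge> 0"
  shows "\<not> (\<exists>P::nat. P > 0 \<and>
           (\<exists>u :: int \<Rightarrow> real. periodic_seq P u
              \<and> cyc_variation (cyc_diff (trunc P u)) = 2
              \<and> cyc_variation_plus (map (rel \<chi>\<^sub>0) (trunc P u)) = 2
              \<and> u = (\<lambda>t. - conv_op g (\<lambda>\<tau>. rel \<chi>\<^sub>0 (u \<tau>)) t)))"
proof (intro notI, elim exE conjE)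
  fix P :: nat and u :: "int \<Rightarrow> real"
  assume "P > 0"
    and var: "cyc_variation (cyc_diff (trunc P u)) = 2"
    and feedback: "u = (\<lambda>t. - conv_op g (\<lambda>\<tau>. rel \<chi>\<^sub>0 (u \<tau>)) t)"
  have "0 \<in> supp g"
    using g0_pos by (simp add: supp_def)
  then have "k \<le> 0"
    by (simp add: supp_g)
  then have step: "g (t + 1) \<le> g t" if "t \<ge> 0" for t
    using monotone_onD[OF decreasing, of t "t + 1"] that by (simp add: supp_g)
  have "u t = 0" for t
    by (rule relay_feedback_trivial[of g \<chi>\<^sub>0 u, OF causal summable step dead_zone fun_cong[OF feedback]])
  then have "\<forall>a\<in>set (cyc_diff (trunc P u)). a = 0"
    by (auto simp: cyc_diff_def trunc_def)
  moreover have "cyc_diff (trunc P u) \<noteq> []"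
    using \<open>P > 0\<close> by (simp add: cyc_diff_def trunc_def)
  ultimately show False
    using cyc_variation_eq_neg_1_if_zero var by fastforce
qed

end
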